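(* Let an undirected graph with $m$ vertices $1,\ldots,m$ and $n-m$ edges be given, and let $T$ be the real $(n\times m)$-matrix that maps a vector $x\in\mathbb{R}^m$ to the vector whose components are first $x_1,\ldots,x_m$ and then the $n-m$ weighted differences $$\frac{x_i-x_j}{\sqrt{2}},\quad i<j,$$ one for each edge of the graph, where the edge connects the vertices $i$ and $j$. Let $d_i$ be the degree of the vertex $i$, and let $$g_1=\frac{1}{m}\sum_{i=1}^m d_i,\quad g_2=\frac{1}{m}\sum_{i=1}^m d_i^2$$ be the mean values of the vertex degrees and their squares (so $g_2\geq g_1^2$). Then the expected value and the variance $$E=\frac{1}{n\nu_n}\int_{S^{n-1}}\|T^t\eta\|^2\,d\eta,\quad V=\frac{1}{n\nu_n}\int_{S^{n-1}}\big(\|T^t\eta\|^2-E\big)^2\,d\eta$$ are $$E=1,\quad V=\frac{2g_2+6g_1}{(g_1^2+4g_1+4)\,m+(4g_1+8)}.$$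
   Context: Graphs are simple (no loops, at most one edge between two vertices); the degree of a vertex is the number of edges meeting at it. $\|\cdot\|$ is the Euclidean norm, $T^t$ is the transpose of $T$, $S^{n-1}$ is the unit sphere of $\mathbb{R}^n$ with surface measure $d\eta$, and $\nu_n$ is the volume of the unit ball of $\mathbb{R}^n$. *)

theory Defs
  imports "HOL-Analysis.Analysis"
begin

text \<open>
  A simple graph on the vertex type \<open>'v\<close> is given by its set of edges, each edge being the
  two-element set of the vertices it connects.
\<close>

definition simple_graph :: "'v set set \<Rightarrow> bool"
  where "simple_graph G \<longleftrightarrow> (\<forall>e\<in>G. card e = 2)"

definition degree :: "'v set set \<Rightarrow> 'v \<Rightarrow> nat"
  where "degree G v = card {e \<in> G. v \<in> e}"

text \<open>
  The row labelling \<open>r\<close> tells which component of the extended vector belongs to which vertex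
  or edge; it takes the place of the numbering \<open>1, \<dots>, n\<close> of the components. For an edge
  with end points \<open>i < j\<close>, \<open>Min e = i\<close> and \<open>Max e = j\<close>.
\<close>

definition row_labelling :: "'v set set \<Rightarrow> ('n \<Rightarrow> 'v + 'v set) \<Rightarrow> bool"
  where "row_labelling G r \<longleftrightarrow> bij_betw r UNIV (UNIV <+> G)"

definition extended_vector ::
    "('n::finite \<Rightarrow> 'v + 'v set) \<Rightarrow> real^'v::{finite,linorder} \<Rightarrow> real^'n"
  where "extended_vector r x =
    (\<chi> k. case r k of Inl i \<Rightarrow> x $ i | Inr e \<Rightarrow> (x $ Min e - x $ Max e) / sqrt 2)"

text \<open>
  The surface measure on the unit sphere of an \<open>n\<close>-dimensional Euclidean space. A Borel set
  \<open>A\<close> of the sphere has the surface area \<open>n\<close> times the volume of the cone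
  \<open>{r \<eta>. \<eta> \<in> A, 0 < r < 1}\<close>. This is the measure \<open>d\<eta>\<close> in the polar coordinate
  formula \<open>\<integral> f(x) dx = \<integral> \<integral> f(r \<eta>) r^(n-1) dr d\<eta>\<close>. For \<open>n = 1\<close>, it is the counting measure.
\<close>

definition surface_measure :: "'a::euclidean_space measure"
  where "surface_measure = scale_measure (of_nat DIM('a))
    (distr (restrict_space lborel (ball 0 1 - {0})) (restrict_space borel (sphere 0 1))
      (\<lambda>x. x /\<^sub>R norm x))"

lemma space_surface_measure: "space surface_measure = sphere (0::'a::euclidean_space) 1"
  by (simp add: surface_measure_def space_restrict_space space_scale_measure)

lemma emeasure_surface_measure:
  fixes A :: "'a::euclidean_space set"
  assumes "A \<in> sets borel" "A \<subseteq> sphere 0 1"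
  shows "emeasure surface_measure A =
    of_nat DIM('a) * emeasure lborel {r *\<^sub>R \<eta> |r \<eta>. 0 < r \<and> r < 1 \<and> \<eta> \<in> A}"
proof -
  let ?B = "ball 0 1 - {0} :: 'a set"
  let ?f = "\<lambda>x::'a. x /\<^sub>R norm x"
  have sgn: "?f x \<in> sphere 0 1" if "x \<in> ?B" for x
    using that by (auto simp: dist_norm)
  have "continuous_on ?B ?f"
    by (intro continuous_intros) auto
  hence "?f \<in> borel_measurable (restrict_space borel ?B)"
    by (intro borel_measurable_continuous_on_restrict)
  hence "?f \<in> measurable (restrict_space lborel ?B) borel"
    using measurable_cong_sets[OF sets_restrict_space_cong[OF sets_lborel] refl] by blast
  hence meas: "?f \<in> measurable (restrict_space lborel ?B) (restrict_space borel (sphere 0 1))"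
    by (intro measurable_restrict_space2) (use sgn in \<open>auto simp: space_restrict_space\<close>)
  have A: "A \<in> sets (restrict_space borel (sphere 0 1))"
    using assms by (auto simp: sets_restrict_space)
  have "?f -` A \<inter> ?B = {r *\<^sub>R \<eta> |r \<eta>. 0 < r \<and> r < 1 \<and> \<eta> \<in> A}"
  proof (intro equalityI subsetI)
    fix x assume x: "x \<in> ?f -` A \<inter> ?B"
    hence "x = norm x *\<^sub>R ?f x" by auto
    with x show "x \<in> {r *\<^sub>R \<eta> |r \<eta>. 0 < r \<and> r < 1 \<and> \<eta> \<in> A}"
      by (intro CollectI exI[of _ "norm x"] exI[of _ "?f x"]) auto
  next
    fix x assume "x \<in> {r *\<^sub>R \<eta> |r \<eta>. 0 < r \<and> r < 1 \<and> \<eta> \<in> A}"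
    then obtain r \<eta> where "x = r *\<^sub>R \<eta>" "0 < r" "r < 1" "\<eta> \<in> A" by blast
    moreover from this assms have "norm \<eta> = 1" by auto
    ultimately show "x \<in> ?f -` A \<inter> ?B" by auto
  qed
  moreover from this have "?f -` A \<inter> ?B \<subseteq> ?B" by blast
  ultimately show ?thesis
    using meas A
    by (simp add: surface_measure_def emeasure_distr emeasure_restrict_space space_restrict_space
        del: Diff_iff subset_Diff_insert)
qed

lemma emeasure_surface_measure_sphere:
  "emeasure surface_measure (sphere (0::'a::euclidean_space) 1) =
    of_nat DIM('a) * emeasure lborel (ball (0::'a) 1)"
proof -
  have "{r *\<^sub>R \<eta> |r \<eta>. 0 < r \<and> r < 1 \<and> \<eta> \<in> sphere (0::'a) 1} = ball 0 1 - {0}"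
  proof (intro equalityI subsetI)
    fix x :: 'a assume "x \<in> ball 0 1 - {0}"
    then show "x \<in> {r *\<^sub>R \<eta> |r \<eta>. 0 < r \<and> r < 1 \<and> \<eta> \<in> sphere (0::'a) 1}"
      by (intro CollectI exI[of _ "norm x"] exI[of _ "x /\<^sub>R norm x"]) auto
  qed auto
  moreover have "emeasure lborel (ball 0 1 - {0::'a}) = emeasure lborel (ball (0::'a) 1)"
    by (rule emeasure_Diff_null_set) auto
  ultimately show ?thesis
    using emeasure_surface_measure[of "sphere (0::'a) 1"] by simp
qed

text \<open>The mean over the unit sphere; \<open>n \<nu>\<^sub>n\<close>, with \<open>\<nu>\<^sub>n\<close> the volume of the unit ball, is its area.\<close>

definition sphere_mean :: "('a::euclidean_space \<Rightarrow> real) \<Rightarrow> real"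
  where "sphere_mean f =
    1 / (real DIM('a) * measure lborel (ball (0::'a) 1)) * (\<integral>\<eta>. f \<eta> \<partial>surface_measure)"

end

theory Submission
  imports Defs
begin

text \<open>
  The surface measure is invariant under orthogonal maps, so the mean of \<open>(a \<bullet> \<eta>)\<^sup>4\<close> over the
  sphere is a multiple \<open>\<kappa> (a \<bullet> a)\<^sup>2\<close>. Polarization turns this into the mean of
  \<open>(a \<bullet> \<eta>)\<^sup>2 (b \<bullet> \<eta>)\<^sup>2\<close>, and summing that over an orthonormal basis determines \<open>\<kappa>\<close>.
  Hence \<open>E\<close> and \<open>V\<close> are determined by the traces of the Gram matrix of the columns of \<open>T\<close>
  and of its square. The Gram matrix is \<open>I + L / 2\<close> with the Laplacian \<open>L\<close> of the graph,
  so that both traces can be read off the degrees.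
\<close>

section \<open>Invariance of volume and surface measure under orthogonal maps\<close>

lemma nn_integral_lborel_translate:
  fixes c :: "'a::euclidean_space"
  assumes [measurable]: "g \<in> borel_measurable borel"
  shows "(\<integral>\<^sup>+x. g (c + x) \<partial>lborel) = (\<integral>\<^sup>+x. g x \<partial>lborel)"
proof -
  have "(\<integral>\<^sup>+x. g x \<partial>lborel) = (\<integral>\<^sup>+x. g x \<partial>distr lborel borel ((+) c))"
    by (simp add: lborel_distr_plus)
  also have "\<dots> = (\<integral>\<^sup>+x. g (c + x) \<partial>lborel)"
    by (intro nn_integral_distr) auto
  finally show ?thesis ..
qed

text \<open>
  The uniqueness argument for Haar measures: the volumes of \<open>A\<close> and of a ball \<open>B\<close> are
  interchanged by Fubini's theorem and translation invariance, and \<open>f\<close> preserves \<open>B\<close>.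
  The library result on orthogonal images is limited to well-ordered index types.
\<close>

lemma emeasure_lborel_orthogonal_vimage:
  fixes f :: "'a::euclidean_space \<Rightarrow> 'a"
  assumes f: "orthogonal_transformation f" and A [measurable]: "A \<in> sets borel"
  shows "emeasure lborel (f -` A) = emeasure lborel A"
proof -
  have lin: "linear f"
    using f by (simp add: orthogonal_transformation)
  have norm_f: "norm (f x) = norm x" for x
    using f by (simp add: orthogonal_transformation)
  have surj: "surj f"
    using f by (rule orthogonal_transformation_surj)
  have [measurable]: "f \<in> borel_measurable borel"
    using lin by (simp add: borel_measurable_continuous_onI linear_continuous_on
        linear_conv_bounded_linear)
  define B :: "'a set" where "B = ball 0 1"
  have [measurable]: "B \<in> sets borel"
    by (simp add: B_def)
  let ?i = "\<lambda>S x. indicator S x :: ennreal"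
  \<comment> \<open>As \<open>f\<close> is surjective, a translation outside \<open>f\<close> is a
    translation of its argument, under which \<open>lborel\<close> is invariant.\<close>
  have shift: "(\<integral>\<^sup>+x. g (y + f x) \<partial>lborel) = (\<integral>\<^sup>+x. g (f x) \<partial>lborel)"
    if [measurable]: "g \<in> borel_measurable borel" for g :: "'a \<Rightarrow> ennreal" and y
  proof -
    obtain z where "y = f z"
      using surj by blast
    then have "(\<integral>\<^sup>+x. g (y + f x) \<partial>lborel) = (\<integral>\<^sup>+x. g (f (z + x)) \<partial>lborel)"
      by (simp add: linear_add[OF lin])
    also have "\<dots> = (\<integral>\<^sup>+x. g (f x) \<partial>lborel)"
      by (rule nn_integral_lborel_translate) measurable
    finally show ?thesis .
  qed
  have vim: "(\<integral>\<^sup>+x. ?i S (f x) \<partial>lborel) = emeasure lborel (f -` S)"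
    if [measurable]: "S \<in> sets borel" for S
  proof -
    have "f -` S \<in> sets lborel"
      using measurable_sets[of f borel borel S] by simp
    moreover have "(\<lambda>x. ?i S (f x)) = ?i (f -` S)"
      by (auto simp: indicator_def)
    ultimately show ?thesis
      by simp
  qed
  have ball_vim: "f -` B = B"
    by (auto simp: B_def norm_f)
  have ball_shift: "(\<integral>\<^sup>+x. ?i B (f x - y) \<partial>lborel) = emeasure lborel B" for y
    using shift[of "?i B" "- y"] by (simp add: vim ball_vim)
  have "emeasure lborel B * emeasure lborel (f -` A)
      = (\<integral>\<^sup>+y. ?i B y * (\<integral>\<^sup>+x. ?i A (y + f x) \<partial>lborel) \<partial>lborel)"
    by (simp add: shift vim nn_integral_multc)
  also have "\<dots> = (\<integral>\<^sup>+y. \<integral>\<^sup>+x. ?i B y * ?i A (y + f x) \<partial>lborel \<partial>lborel)"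
    by (simp add: nn_integral_cmult)
  also have "\<dots> = (\<integral>\<^sup>+x. \<integral>\<^sup>+y. ?i B y * ?i A (y + f x) \<partial>lborel \<partial>lborel)"
    by (rule lborel_pair.Fubini') measurable
  \<comment> \<open>The inner translation by \<open>f x\<close> moves \<open>f\<close> from the
    indicator of \<open>A\<close> to that of the ball, where its effect is known.\<close>
  also have "\<dots> = (\<integral>\<^sup>+x. \<integral>\<^sup>+y. ?i B (y - f x) * ?i A y \<partial>lborel \<partial>lborel)"
  proof (rule nn_integral_cong)
    fix x
    show "(\<integral>\<^sup>+y. ?i B y * ?i A (y + f x) \<partial>lborel) = (\<integral>\<^sup>+y. ?i B (y - f x) * ?i A y \<partial>lborel)"
      using nn_integral_lborel_translate[of "\<lambda>y. ?i B (y - f x) * ?i A y" "f x"]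
      by (simp add: add.commute)
  qed
  also have "\<dots> = (\<integral>\<^sup>+y. \<integral>\<^sup>+x. ?i B (y - f x) * ?i A y \<partial>lborel \<partial>lborel)"
    by (rule lborel_pair.Fubini') measurable
  \<comment> \<open>The symmetry of the ball about 0 permits the sign change that brings the
    integrand into the form of \<open>ball_shift\<close>.\<close>
  also have "\<dots> = (\<integral>\<^sup>+y. \<integral>\<^sup>+x. ?i B (f x - y) * ?i A y \<partial>lborel \<partial>lborel)"
    by (intro nn_integral_cong)
      (auto simp: B_def indicator_def norm_minus_commute)
  also have "\<dots> = (\<integral>\<^sup>+y. emeasure lborel B * ?i A y \<partial>lborel)"
    by (simp add: nn_integral_multc ball_shift)
  also have "\<dots> = emeasure lborel B * emeasure lborel A"
    by (simp add: nn_integral_cmult)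
  \<comment> \<open>Cancellation in \<open>ennreal\<close> requires the volume of the ball to be
    neither 0 nor infinite.\<close>
  finally show ?thesis
    using emeasure_lborel_ball_finite[of "0::'a" 1]
      unit_ball_vol_pos[OF of_nat_0_le_iff, of "DIM('a)"]
    by (auto simp: ennreal_mult_cancel_left B_def emeasure_ball)
qed

text \<open>A linear isometry commutes with the normalization \<open>x /\<^sub>R norm x\<close>, so
  the cone over the preimage of a set is the preimage of its cone. Invariance of the surface measure
  thus reduces to that of the volume.\<close>

lemma distr_surface_measure_orthogonal:
  fixes f :: "'a::euclidean_space \<Rightarrow> 'a"
  assumes f: "orthogonal_transformation f"
  shows "f \<in> measurable surface_measure surface_measure"
    and "distr surface_measure surface_measure f = surface_measure"
proof -
  have lin: "linear f"
    using f by (simp add: orthogonal_transformation)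
  have norm_f: "norm (f x) = norm x" for x
    using f by (simp add: orthogonal_transformation)
  have f_borel [measurable]: "f \<in> borel_measurable borel"
    using lin by (simp add: borel_measurable_continuous_onI linear_continuous_on
        linear_conv_bounded_linear)
  have sets: "sets surface_measure = sets (restrict_space borel (sphere (0::'a) 1))"
    by (simp add: surface_measure_def)
  show meas: "f \<in> measurable surface_measure surface_measure"
    unfolding measurable_cong_sets[OF sets sets]
    by (intro measurable_restrict_space3) (auto simp: norm_f)
  show "distr surface_measure surface_measure f = surface_measure"
  proof (rule measure_eqI)
    fix A assume A: "A \<in> sets (distr surface_measure surface_measure f)"
    then have A_borel [measurable]: "A \<in> sets borel" and A_sph: "A \<subseteq> sphere 0 1"
      by (auto simp: sets sets_restrict_space)
    let ?cone = "\<lambda>S. {r *\<^sub>R \<eta> |r \<eta>. 0 < r \<and> r < 1 \<and> \<eta> \<in> S} :: 'a set"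
    \<comment> \<open>Describing the cone by conditions on \<open>x\<close> itself makes it easy to
      form its preimage and to see that it is Borel.\<close>
    have cone: "?cone S = {x. norm x < 1 \<and> x \<noteq> 0 \<and> x /\<^sub>R norm x \<in> S}"
      if "S \<subseteq> sphere 0 1" for S
    proof (intro equalityI subsetI)
      fix x assume "x \<in> {x. norm x < 1 \<and> x \<noteq> 0 \<and> x /\<^sub>R norm x \<in> S}"
      then show "x \<in> ?cone S"
        by (intro CollectI exI[of _ "norm x"] exI[of _ "x /\<^sub>R norm x"]) auto
    next
      fix x assume "x \<in> ?cone S"
      then obtain r \<eta> where "x = r *\<^sub>R \<eta>" "0 < r" "r < 1" "\<eta> \<in> S" by blast
      moreover from this that have "norm \<eta> = 1" by auto
      ultimately show "x \<in> {x. norm x < 1 \<and> x \<noteq> 0 \<and> x /\<^sub>R norm x \<in> S}" by auto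
    qed
    have fA: "f -` A \<in> sets borel" "f -` A \<subseteq> sphere 0 1"
      using measurable_sets[OF f_borel A_borel] A_sph by (auto simp: norm_f subset_iff)
    have "f x = 0 \<longleftrightarrow> x = 0" for x
      using norm_f[of x] by (metis norm_eq_zero)
    then have vim: "?cone (f -` A) = f -` ?cone A"
      unfolding cone[OF fA(2)] cone[OF A_sph]
      by (simp only: set_eq_iff vimage_eq mem_Collect_eq norm_f linear_scale[OF lin] simp_thms)
    have cone_borel: "?cone A \<in> sets borel"
      unfolding cone[OF A_sph] by measurable
    have "emeasure (distr surface_measure surface_measure f) A
        = emeasure surface_measure (f -` A \<inter> space surface_measure)"
      using A by (intro emeasure_distr meas) simp
    also have "f -` A \<inter> space surface_measure = f -` A"
      using fA by (auto simp: space_surface_measure)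
    also have "emeasure surface_measure (f -` A) = emeasure surface_measure A"
      using fA A_borel A_sph cone_borel
      by (simp only: emeasure_surface_measure vim emeasure_lborel_orthogonal_vimage[OF f])
    finally show "emeasure (distr surface_measure surface_measure f) A = emeasure surface_measure A" .
  qed simp
qed

section \<open>The mean over the sphere\<close>

text \<open>The sphere is compact and has finite area, so a continuous function on it is bounded and
  integrable.\<close>

lemma integrable_surface_measure:
  fixes g :: "'a::euclidean_space \<Rightarrow> real"
  assumes "continuous_on (sphere 0 1) g"
  shows "integrable surface_measure g"
proof -
  have "finite_measure (surface_measure :: 'a measure)"
    using emeasure_lborel_ball_finite[of "0::'a" 1]
    by (intro finite_measureI)
      (auto simp: space_surface_measure emeasure_surface_measure_sphere ennreal_mult_eq_top_iff)
  moreover have "bounded (g ` sphere 0 1)"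
    using assms by (intro compact_imp_bounded compact_continuous_image) auto
  then obtain C where "\<And>x. x \<in> sphere 0 1 \<Longrightarrow> norm (g x) \<le> C"
    unfolding bounded_iff by blast
  moreover have "g \<in> borel_measurable (restrict_space borel (sphere 0 1))"
    using assms by (rule borel_measurable_continuous_on_restrict)
  then have "g \<in> borel_measurable surface_measure"
    by (subst measurable_cong_sets[of _ "restrict_space borel (sphere 0 1)" _ borel])
      (auto simp: surface_measure_def)
  ultimately show ?thesis
    by (intro finite_measure.integrable_const_bound[where B = C])
      (auto simp: space_surface_measure)
qed

lemma sphere_mean_const: "sphere_mean (\<lambda>_::'a::euclidean_space. c) = c"
proof -
  have "measure (surface_measure :: 'a measure) (sphere 0 1)
      = real DIM('a) * measure lborel (ball (0::'a) 1)"
    by (simp add: measure_def emeasure_surface_measure_sphere enn2real_mult)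
  moreover have "measure lborel (ball (0::'a) 1) \<noteq> 0"
    using content_ball_pos[of 1 "0::'a"] by simp
  ultimately show ?thesis
    by (simp add: sphere_mean_def space_surface_measure)
qed

text \<open>Non-integrable \<open>g\<close> are covered as well: by the convention of the Bochner
  integral, both sides are then 0.\<close>

lemma sphere_mean_cmult:
  "sphere_mean (\<lambda>\<eta>. c * g \<eta>) = c * sphere_mean (g :: 'a::euclidean_space \<Rightarrow> real)"
  by (simp add: sphere_mean_def)

lemma sphere_mean_add:
  fixes g h :: "'a::euclidean_space \<Rightarrow> real"
  assumes "continuous_on (sphere 0 1) g" "continuous_on (sphere 0 1) h"
  shows "sphere_mean (\<lambda>\<eta>. g \<eta> + h \<eta>) = sphere_mean g + sphere_mean h"
  using assms by (simp add: sphere_mean_def integrable_surface_measure add_divide_distrib)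

lemma sphere_mean_sum:
  fixes g :: "'i \<Rightarrow> 'a::euclidean_space \<Rightarrow> real"
  assumes "\<And>i. i \<in> I \<Longrightarrow> continuous_on (sphere 0 1) (g i)"
  shows "sphere_mean (\<lambda>\<eta>. \<Sum>i\<in>I. g i \<eta>) = (\<Sum>i\<in>I. sphere_mean (g i))"
  using assms by (simp add: sphere_mean_def integrable_surface_measure sum_distrib_left)

lemma sphere_mean_cong:
  fixes g h :: "'a::euclidean_space \<Rightarrow> real"
  assumes "\<And>\<eta>. norm \<eta> = 1 \<Longrightarrow> g \<eta> = h \<eta>"
  shows "sphere_mean g = sphere_mean h"
  unfolding sphere_mean_def using assms
  by (metis (mono_tags, lifting) Bochner_Integration.integral_cong mem_sphere_0
      space_surface_measure)

lemma sphere_mean_orthogonal: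
  fixes f :: "'a::euclidean_space \<Rightarrow> 'a"
  assumes f: "orthogonal_transformation f" and g: "continuous_on (sphere 0 1) g"
  shows "sphere_mean (\<lambda>\<eta>. g (f \<eta>)) = sphere_mean g"
proof -
  have "(\<integral>\<eta>. g \<eta> \<partial>surface_measure) = (\<integral>\<eta>. g \<eta> \<partial>distr surface_measure surface_measure f)"
    by (simp add: distr_surface_measure_orthogonal[OF f])
  also have "\<dots> = (\<integral>\<eta>. g (f \<eta>) \<partial>surface_measure)"
    by (intro integral_distr distr_surface_measure_orthogonal f)
      (rule borel_measurable_integrable[OF integrable_surface_measure[OF g]])
  finally show ?thesis
    by (simp add: sphere_mean_def)
qed

section \<open>Second and fourth moments of linear forms\<close>

text \<open>The witness is the Householder reflection along \<open>a - b\<close>.\<close>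

lemma orthogonal_transformation_of_equal_norm:
  fixes a b :: "'a::real_inner"
  assumes "norm a = norm b"
  obtains f :: "'a \<Rightarrow> 'a" where "orthogonal_transformation f" "f a = b"
proof (cases "a = b")
  case True
  then show ?thesis
    using that[of id] by (simp add: id_def)
next
  case False
  define w where "w = a - b"
  define f where "f x = x - (2 * (w \<bullet> x) / (w \<bullet> w)) *\<^sub>R w" for x
  have w: "w \<bullet> w \<noteq> 0"
    using False by (simp add: w_def)
  have "a \<bullet> a = b \<bullet> b"
    using assms by (simp add: dot_square_norm)
  \<comment> \<open>Here the equality of the norms enters. It makes the coefficient of
    \<open>w\<close> in \<open>f a\<close> equal to 1, whence
    \<open>f a = a - w = b\<close>.\<close>
  then have "w \<bullet> w = 2 * (w \<bullet> a)"
    by (simp add: w_def algebra_simps inner_commute)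
  then have fa: "f a = b"
    using w by (simp add: f_def) (simp add: w_def)
  have lin: "linear f"
    by (intro linearI) (simp_all add: f_def algebra_simps inner_add_right add_divide_distrib)
  have "f x \<bullet> f x = x \<bullet> x" for x
    using w by (simp add: f_def inner_diff_left inner_diff_right inner_commute field_simps)
  then have "norm (f x) = norm x" for x
    by (simp add: norm_eq_sqrt_inner)
  then show ?thesis
    using that[of f] lin fa by (simp add: orthogonal_transformation)
qed

text \<open>Orthogonal maps carry every unit vector to the fixed \<open>e\<close>, so all unit
  vectors share one fourth moment, which serves as \<kappa>. Homogeneity of degree 4 does the rest.
  The value of \<kappa> is left open here.\<close>

lemma sphere_mean_fourth_moment:
  obtains \<kappa> where "\<And>a::'a::euclidean_space. sphere_mean (\<lambda>\<eta>. (a \<bullet> \<eta>) ^ 4) = \<kappa> * (a \<bullet> a)\<^sup>2"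
proof -
  obtain e :: 'a where e: "e \<in> Basis"
    using nonempty_Basis by blast
  have unit: "sphere_mean (\<lambda>\<eta>. (a \<bullet> \<eta>) ^ 4) = sphere_mean (\<lambda>\<eta>. (e \<bullet> \<eta>) ^ 4)"
    if "norm a = 1" for a :: 'a
  proof -
    obtain f where f: "orthogonal_transformation f" "f a = e"
      using orthogonal_transformation_of_equal_norm[of a e] e \<open>norm a = 1\<close> by auto
    \<comment> \<open>Since \<open>f\<close> preserves inner products, \<open>e \<bullet> f \<eta> =
      f a \<bullet> f \<eta> = a \<bullet> \<eta>\<close>.\<close>
    then have "e \<bullet> f \<eta> = a \<bullet> \<eta>" for \<eta>
      by (auto simp: orthogonal_transformation_def)
    then show ?thesis
      using sphere_mean_orthogonal[OF f(1), of "\<lambda>\<eta>. (e \<bullet> \<eta>) ^ 4"]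
      by (simp add: continuous_intros)
  qed
  have "sphere_mean (\<lambda>\<eta>. (a \<bullet> \<eta>) ^ 4) = sphere_mean (\<lambda>\<eta>. (e \<bullet> \<eta>) ^ 4) * (a \<bullet> a)\<^sup>2"
    for a :: 'a
  proof (cases "a = 0")
    case True
    then show ?thesis
      by (simp add: sphere_mean_const)
  next
    case False
    have "a \<bullet> \<eta> = norm a * ((a /\<^sub>R norm a) \<bullet> \<eta>)" for \<eta>
      using False by simp
    then have "(a \<bullet> \<eta>) ^ 4 = norm a ^ 4 * ((a /\<^sub>R norm a) \<bullet> \<eta>) ^ 4" for \<eta>
      by (metis power_mult_distrib)
    moreover have "norm a ^ 4 = (a \<bullet> a)\<^sup>2"
      by (simp add: dot_square_norm flip: power_mult)
    ultimately show ?thesis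
      using unit[of "a /\<^sub>R norm a"] False by (simp only: sphere_mean_cmult) simp
  qed
  then show ?thesis
    by (rule that)
qed

text \<open>The analogue on the sphere of the Gaussian moment formula: the numerator sums over the
  three pairings of the factors \<open>a, a, b, b\<close>, and the denominator is the normalization
  peculiar to the sphere.\<close>

lemma sphere_mean_inner_square_product:
  fixes a b :: "'a::euclidean_space"
  shows "sphere_mean (\<lambda>\<eta>. (a \<bullet> \<eta>)\<^sup>2 * (b \<bullet> \<eta>)\<^sup>2)
    = ((a \<bullet> a) * (b \<bullet> b) + 2 * (a \<bullet> b)\<^sup>2) / (real DIM('a) * (real DIM('a) + 2))"
proof -
  let ?n = "real DIM('a)"
  obtain \<kappa> where \<kappa>: "\<And>a::'a. sphere_mean (\<lambda>\<eta>. (a \<bullet> \<eta>) ^ 4) = \<kappa> * (a \<bullet> a)\<^sup>2"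
    using sphere_mean_fourth_moment by blast
  have polar: "sphere_mean (\<lambda>\<eta>. (a \<bullet> \<eta>)\<^sup>2 * (b \<bullet> \<eta>)\<^sup>2) = \<kappa> / 3 * ((a \<bullet> a) * (b \<bullet> b) + 2 * (a \<bullet> b)\<^sup>2)"
    for a b :: 'a
  proof -
    \<comment> \<open>Polarization:
      \<open>12 s^2 t^2 = (s + t)^4 + (s - t)^4 - 2 s^4 - 2 t^4\<close>.\<close>
    have "(a \<bullet> \<eta>)\<^sup>2 * (b \<bullet> \<eta>)\<^sup>2 = 1/12 * (((a + b) \<bullet> \<eta>) ^ 4 + ((a - b) \<bullet> \<eta>) ^ 4
        + ((-2) * (a \<bullet> \<eta>) ^ 4 + (-2) * (b \<bullet> \<eta>) ^ 4))" for \<eta>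
      by (simp add: inner_add_left inner_diff_left field_simps) algebra
    then have "sphere_mean (\<lambda>\<eta>. (a \<bullet> \<eta>)\<^sup>2 * (b \<bullet> \<eta>)\<^sup>2)
      = 1/12 * (\<kappa> * ((a + b) \<bullet> (a + b))\<^sup>2 + \<kappa> * ((a - b) \<bullet> (a - b))\<^sup>2
        + ((-2) * (\<kappa> * (a \<bullet> a)\<^sup>2) + (-2) * (\<kappa> * (b \<bullet> b)\<^sup>2)))"
      by (simp only: sphere_mean_cmult sphere_mean_add continuous_intros \<kappa>)
    also have "\<dots> = \<kappa> / 3 * ((a \<bullet> a) * (b \<bullet> b) + 2 * (a \<bullet> b)\<^sup>2)"
      by (simp add: inner_add_left inner_diff_left inner_add_right inner_diff_right
          inner_commute[of b a] field_simps) algebra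
    finally show ?thesis .
  qed
  have inner_b: "(\<Sum>j\<in>Basis. (i \<bullet> j)\<^sup>2) = 1" if "i \<in> Basis" for i :: 'a
    using euclidean_inner[of i i] that by (simp add: power2_eq_square)
  \<comment> \<open>To determine \<kappa>, the constant 1 is written as the square of the sum of the
    \<open>(i \<bullet> \<eta>)\<^sup>2\<close> over the basis and averaged termwise. The diagonal
    terms produce the summand 2 in \<open>?n + 2\<close>.\<close>
  have "1 = sphere_mean (\<lambda>\<eta>::'a. 1)"
    by (simp add: sphere_mean_const)
  also have "\<dots> = sphere_mean (\<lambda>\<eta>::'a. \<Sum>i\<in>Basis. \<Sum>j\<in>Basis. (i \<bullet> \<eta>)\<^sup>2 * (j \<bullet> \<eta>)\<^sup>2)"
  proof (rule sphere_mean_cong)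
    fix \<eta> :: 'a assume "norm \<eta> = 1"
    then have "(\<Sum>i\<in>Basis. (i \<bullet> \<eta>)\<^sup>2) = 1"
      using euclidean_inner[of \<eta> \<eta>] by (simp add: dot_square_norm power2_eq_square inner_commute)
    then show "1 = (\<Sum>i\<in>Basis. \<Sum>j\<in>Basis. (i \<bullet> \<eta>)\<^sup>2 * (j \<bullet> \<eta>)\<^sup>2)"
      by (simp flip: sum_distrib_left)
  qed
  also have "\<dots> = (\<Sum>i\<in>(Basis::'a set). \<Sum>j\<in>Basis. \<kappa> / 3 * ((i \<bullet> i) * (j \<bullet> j) + 2 * (i \<bullet> j)\<^sup>2))"
    by (simp only: sphere_mean_sum continuous_intros polar)
  also have "\<dots> = (\<Sum>i\<in>(Basis::'a set). \<kappa> / 3 * (?n + 2))"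
    by (intro sum.cong refl, simp only: sum_distrib_left[symmetric] sum.distrib)
      (simp add: inner_b)
  also have "\<dots> = \<kappa> / 3 * (?n * (?n + 2))"
    by simp
  finally have "1 = \<kappa> / 3 * (?n * (?n + 2))" .
  moreover have "?n * (?n + 2) \<noteq> 0"
    by (simp add: add_nonneg_eq_0_iff)
  ultimately have "\<kappa> / 3 = 1 / (?n * (?n + 2))"
    by (metis nonzero_eq_divide_eq)
  then show ?thesis
    unfolding polar by simp
qed

text \<open>Multiplying by the sum of the \<open>(j \<bullet> \<eta>)\<^sup>2\<close>, which is 1 on
  the sphere, reduces the second moment to the fourth moments already known.\<close>

lemma sphere_mean_inner_square:
  fixes a :: "'a::euclidean_space"
  shows "sphere_mean (\<lambda>\<eta>. (a \<bullet> \<eta>)\<^sup>2) = (a \<bullet> a) / real DIM('a)"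
proof -
  let ?n = "real DIM('a)"
  have "sphere_mean (\<lambda>\<eta>. (a \<bullet> \<eta>)\<^sup>2) = sphere_mean (\<lambda>\<eta>. \<Sum>j\<in>Basis. (a \<bullet> \<eta>)\<^sup>2 * (j \<bullet> \<eta>)\<^sup>2)"
  proof (rule sphere_mean_cong)
    fix \<eta> :: 'a assume "norm \<eta> = 1"
    then have "(\<Sum>i\<in>Basis. (i \<bullet> \<eta>)\<^sup>2) = 1"
      using euclidean_inner[of \<eta> \<eta>] by (simp add: dot_square_norm power2_eq_square inner_commute)
    then show "(a \<bullet> \<eta>)\<^sup>2 = (\<Sum>j\<in>Basis. (a \<bullet> \<eta>)\<^sup>2 * (j \<bullet> \<eta>)\<^sup>2)"
      by (simp flip: sum_distrib_left)
  qed
  also have "\<dots> = (\<Sum>j\<in>Basis. ((a \<bullet> a) * (j \<bullet> j) + 2 * (a \<bullet> j)\<^sup>2) / (?n * (?n + 2)))"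
    by (simp only: sphere_mean_sum continuous_intros sphere_mean_inner_square_product)
  also have "\<dots> = (?n * (a \<bullet> a) + 2 * (\<Sum>j\<in>Basis. (a \<bullet> j)\<^sup>2)) / (?n * (?n + 2))"
    by (simp add: inner_same_Basis sum.distrib flip: sum_divide_distrib sum_distrib_left)
  also have "(\<Sum>j\<in>Basis. (a \<bullet> j)\<^sup>2) = a \<bullet> a"
    using euclidean_inner[of a a] by (simp add: power2_eq_square)
  also have "(?n * (a \<bullet> a) + 2 * (a \<bullet> a)) / (?n * (?n + 2)) = (a \<bullet> a) / ?n"
    by (simp add: divide_simps) (simp add: algebra_simps)
  finally show ?thesis .
qed

section \<open>The Gram matrix of the columns and the vertex degrees\<close>

text \<open>This turns the integrand into a sum of squares of linear forms, to which the moment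
  formulas apply.\<close>

lemma norm_transpose_matrix_square:
  fixes T :: "real^'m^'n"
  shows "(norm (transpose T *v \<eta>))\<^sup>2 = (\<Sum>p\<in>UNIV. (column p T \<bullet> \<eta>)\<^sup>2)"
proof -
  have "(transpose T *v \<eta>) $ p = column p T \<bullet> \<eta>" for p
    unfolding matrix_vector_mul_component transpose_def column_def row_def by simp
  then show ?thesis
    unfolding norm_vec_def L2_set_def by (simp add: sum_nonneg)
qed

text \<open>The vertex rows contribute the identity matrix. An edge row has just the two nonzero
  entries \<open>1 / sqrt 2\<close> and \<open>- 1 / sqrt 2\<close>, at its end points, so it adds
  1/2 to two diagonal entries and -1/2 to the entries joining them. The orientation of the edge
  drops out of these products.\<close>

lemma column_inner_extended_vector:
  fixes G :: "'m::{finite,linorder} set set"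
    and r :: "'n::finite \<Rightarrow> 'm + 'm set"
    and T :: "real^('m::{finite,linorder})^'n"
  assumes G: "simple_graph G" and r: "row_labelling G r"
    and T: "\<forall>x. T *v x = extended_vector r x"
  shows "column p T \<bullet> column q T
    = (if p = q then 1 + real (degree G p) / 2 else if {p, q} \<in> G then - 1 / 2 else 0)"
proof -
  \<comment> \<open>\<open>?a l p\<close> is the entry of \<open>T\<close> in the row labelled
    \<open>l\<close> and column \<open>p\<close>.\<close>
  let ?a = "\<lambda>l p. case l of Inl i \<Rightarrow> (if i = p then 1 else 0)
    | Inr e \<Rightarrow> ((if Min e = p then 1 else 0) - (if Max e = p then 1 else 0)) / sqrt 2"
  have col: "column p T $ k = ?a (r k) p" for k p
  proof -
    have "column p T = extended_vector r (axis p 1)"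
      using T matrix_vector_mult_basis[of T p] by simp
    then show ?thesis
      by (simp add: extended_vector_def axis_def split: sum.split)
  qed
  have edge: "?a (Inr e) p * ?a (Inr e) q =
      (if p = q then if p \<in> e then 1 / 2 else 0 else if e = {p, q} then - 1 / 2 else 0)"
    if "e \<in> G" for e
  proof -
    have "card e = 2"
      using G that by (simp add: simple_graph_def)
    then obtain x y where e: "e = {x, y}" "x < y"
      by (metis card_2_iff insert_commute neq_iff)
    then have "Min e = x" "Max e = y"
      by auto
    then show ?thesis
      using e by (auto simp: doubleton_eq_iff)
  qed
  have "column p T \<bullet> column q T = (\<Sum>k\<in>UNIV. ?a (r k) p * ?a (r k) q)"
    by (simp only: inner_vec_def col inner_real_def)
  also have "\<dots> = (\<Sum>l\<in>UNIV <+> G. ?a l p * ?a l q)"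
    using r by (intro sum.reindex_bij_betw) (simp add: row_labelling_def)
  also have "\<dots> = (\<Sum>i\<in>UNIV. ?a (Inl i) p * ?a (Inl i) q) + (\<Sum>e\<in>G. ?a (Inr e) p * ?a (Inr e) q)"
    by (subst sum.Plus) auto
  also have "(\<Sum>i\<in>UNIV. ?a (Inl i) p * ?a (Inl i) q) = (if p = q then 1 else 0)"
    by (simp add: if_distrib[of "\<lambda>x. x * _"] cong: if_cong)
  also have "(\<Sum>e\<in>G. ?a (Inr e) p * ?a (Inr e) q)
      = (\<Sum>e\<in>G. if p = q then if p \<in> e then 1 / 2 else 0 else if e = {p, q} then - 1 / 2 else 0)"
    by (intro sum.cong edge refl)
  also have "\<dots> = (if p = q then real (degree G p) / 2 else if {p, q} \<in> G then - 1 / 2 else 0)"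
    by (simp add: degree_def sum.If_cases Int_def)
  finally show ?thesis
    by simp
qed

text \<open>An edge at \<open>p\<close> is determined by its other end point. In this form the
  degree counts the nonzero off-diagonal entries in row \<open>p\<close> of the Gram matrix.\<close>

lemma degree_eq_card_neighbours:
  assumes "simple_graph G"
  shows "degree G p = card {q. q \<noteq> p \<and> {p, q} \<in> G}"
proof -
  have "bij_betw (\<lambda>q. {p, q}) {q. q \<noteq> p \<and> {p, q} \<in> G} {e \<in> G. p \<in> e}"
  proof (rule bij_betw_imageI)
    show "inj_on (\<lambda>q. {p, q}) {q. q \<noteq> p \<and> {p, q} \<in> G}"
      by (auto simp: inj_on_def doubleton_eq_iff)
    have "\<exists>q. q \<noteq> p \<and> e = {p, q}" if "e \<in> G" "p \<in> e" for e
    proof -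
      have "card e = 2"
        using assms that by (simp add: simple_graph_def)
      then show ?thesis
        using \<open>p \<in> e\<close> by (auto simp: card_2_iff)
    qed
    then show "(\<lambda>q. {p, q}) ` {q. q \<noteq> p \<and> {p, q} \<in> G} = {e \<in> G. p \<in> e}"
      by fastforce
  qed
  then show ?thesis
    by (simp add: degree_def bij_betw_same_card)
qed

text \<open>The handshake lemma, by counting the incident pairs of vertices and edges in both
  orders.\<close>

lemma sum_degree_eq_twice_card_edges:
  fixes G :: "'m::finite set set"
  assumes "simple_graph G"
  shows "(\<Sum>p\<in>UNIV. degree G p) = 2 * card G"
proof -
  have "(\<Sum>p\<in>UNIV. degree G p) = (\<Sum>p\<in>UNIV. \<Sum>e\<in>G. if p \<in> e then 1 else 0)"
    by (simp add: degree_def sum.If_cases Int_def)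
  also have "\<dots> = (\<Sum>e\<in>G. \<Sum>p\<in>UNIV. if p \<in> e then 1 else 0)"
    by (rule sum.swap)
  also have "\<dots> = (\<Sum>e\<in>G. 2)"
    using assms by (intro sum.cong) (auto simp: simple_graph_def sum.If_cases)
  finally show ?thesis
    by simp
qed

section \<open>Expected value and variance\<close>

theorem lemma3p4:
  fixes G :: "'m::{finite,linorder} set set"
    and r :: "'n::finite \<Rightarrow> 'm + 'm set"
    and T :: "real^('m::{finite,linorder})^'n"
    and m g\<^sub>1 g\<^sub>2 E V :: real
  assumes "simple_graph G"
    and "row_labelling G r"
    and "\<forall>x. T *v x = extended_vector r x"
    and "m = real CARD('m)"
    and "g\<^sub>1 = 1 / m * (\<Sum>i\<in>UNIV. real (degree G i))"
    and "g\<^sub>2 = 1 / m * (\<Sum>i\<in>UNIV. (real (degree G i))\<^sup>2)"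
    and "E = sphere_mean (\<lambda>\<eta>::real^'n. (norm (transpose T *v \<eta>))\<^sup>2)"
    and "V = sphere_mean (\<lambda>\<eta>::real^'n. ((norm (transpose T *v \<eta>))\<^sup>2 - E)\<^sup>2)"
  shows "g\<^sub>2 \<ge> g\<^sub>1\<^sup>2 \<and> E = 1 \<and>
    V = (2 * g\<^sub>2 + 6 * g\<^sub>1) / ((g\<^sub>1\<^sup>2 + 4 * g\<^sub>1 + 4) * m + (4 * g\<^sub>1 + 8))"
proof -
  let ?d = "\<lambda>p. real (degree G p)"
  let ?c = "\<lambda>p. column p T"
  let ?Q = "\<lambda>\<eta>. \<Sum>p\<in>UNIV. (?c p \<bullet> \<eta>)\<^sup>2"
  define n where "n = real CARD('n)"
  have n_pos: "n > 0"
    by (simp add: n_def)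
  have m: "m > 0"
    using assms(4) by simp
  have S1: "(\<Sum>p\<in>UNIV. ?d p) = m * g\<^sub>1" and S2: "(\<Sum>p\<in>UNIV. (?d p)\<^sup>2) = m * g\<^sub>2"
    using assms(5,6) m by simp_all
  \<comment> \<open>The Cauchy-Schwarz inequality for the degrees and the constant 1.\<close>
  have "(m * g\<^sub>1)\<^sup>2 \<le> (m * g\<^sub>2) * m"
    using sum_squared_le_sum_of_squares[of ?d UNIV] by (simp add: S1 S2 assms(4))
  then have "m\<^sup>2 * g\<^sub>1\<^sup>2 \<le> m\<^sup>2 * g\<^sub>2"
    by (simp add: power2_eq_square mult_ac)
  then have ineq: "g\<^sub>1\<^sup>2 \<le> g\<^sub>2"
    using m by simp
  note col = column_inner_extended_vector[OF assms(1-3)]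
  \<comment> \<open>There is one row for each vertex and each edge, and the number of edges is
    \<open>m * g\<^sub>1 / 2\<close>. This expresses \<open>n\<close> by \<open>m\<close> and
    \<open>g\<^sub>1\<close>.\<close>
  have "CARD('n) = CARD('m) + card G"
    using assms(2) bij_betw_same_card[of r UNIV "UNIV <+> G"]
    by (simp add: row_labelling_def card_Plus)
  moreover have "(\<Sum>p\<in>UNIV. ?d p) = 2 * real (card G)"
    using sum_degree_eq_twice_card_edges[OF assms(1)] by (simp flip: of_nat_sum)
  ultimately have n: "n = m * (2 + g\<^sub>1) / 2"
    using S1 assms(4) by (simp add: n_def field_simps)
  have g1: "g\<^sub>1 \<ge> 0"
    using assms(5) m by (simp add: sum_nonneg)
  \<comment> \<open>The diagonal entries \<open>1 + ?d p / 2\<close> sum to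
    \<open>m + m * g\<^sub>1 / 2\<close>, which is exactly \<open>n\<close>. This is why the
    expected value is 1.\<close>
  have trace: "(\<Sum>p\<in>UNIV. ?c p \<bullet> ?c p) = n"
    using S1 by (simp add: col sum.distrib n assms(4) field_simps flip: sum_divide_distrib)
  \<comment> \<open>Besides the squared diagonal entry, each of the \<open>?d p\<close> neighbours
    contributes \<open>(- 1 / 2)\<^sup>2 = 1 / 4\<close>.\<close>
  have row_sum: "(\<Sum>q\<in>UNIV. (?c p \<bullet> ?c q)\<^sup>2) = (1 + ?d p / 2)\<^sup>2 + ?d p / 4" for p
  proof -
    have "(\<Sum>q\<in>UNIV. (?c p \<bullet> ?c q)\<^sup>2)
        = (1 + ?d p / 2)\<^sup>2 + (\<Sum>q\<in>UNIV - {p}. if {p, q} \<in> G then 1 / 4 else 0)"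
      by (subst sum.remove[of _ p]) (auto simp: col power2_eq_square intro!: sum.cong split: if_splits)
    also have "(\<Sum>q\<in>UNIV - {p}. if {p, q} \<in> G then 1 / 4 else 0) = ?d p / 4"
    proof -
      have "(UNIV - {p}) \<inter> {q. {p, q} \<in> G} = {q. q \<noteq> p \<and> {p, q} \<in> G}"
        by auto
      then show ?thesis
        by (simp add: degree_eq_card_neighbours[OF assms(1)] sum.If_cases)
    qed
    finally show ?thesis .
  qed
  have trace_square: "(\<Sum>p\<in>UNIV. \<Sum>q\<in>UNIV. (?c p \<bullet> ?c q)\<^sup>2) = n + m * (3 * g\<^sub>1 + g\<^sub>2) / 4"
  proof -
    \<comment> \<open>The coefficient 5/4 splits into 1/2, which together with the constant term
      makes up \<open>n\<close>, and the remaining 3/4.\<close>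
    have "(\<Sum>p\<in>UNIV. \<Sum>q\<in>UNIV. (?c p \<bullet> ?c q)\<^sup>2) = (\<Sum>p\<in>UNIV. 1 + 5 / 4 * ?d p + 1 / 4 * (?d p)\<^sup>2)"
      unfolding row_sum by (intro sum.cong refl) (simp add: power2_eq_square algebra_simps)
    also have "\<dots> = m + 5 / 4 * (m * g\<^sub>1) + 1 / 4 * (m * g\<^sub>2)"
      unfolding S1[symmetric] S2[symmetric] sum_distrib_left
      by (simp add: sum.distrib assms(4))
    finally show ?thesis
      by (simp add: n field_simps)
  qed
  have mean: "sphere_mean ?Q = 1"
  proof -
    have "sphere_mean ?Q = (\<Sum>p\<in>UNIV. (?c p \<bullet> ?c p) / n)"
      by (simp add: sphere_mean_sum continuous_intros sphere_mean_inner_square n_def)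
    then show ?thesis
      using trace by (simp add: n_def flip: sum_divide_distrib)
  qed
  then have E: "E = 1"
    unfolding assms(7) norm_transpose_matrix_square .
  \<comment> \<open>The squared sum is expanded into a double sum whose terms are the mixed fourth
    moments.\<close>
  have "sphere_mean (\<lambda>\<eta>. (?Q \<eta>)\<^sup>2)
      = (\<Sum>p\<in>UNIV. \<Sum>q\<in>UNIV. sphere_mean (\<lambda>\<eta>. (?c p \<bullet> \<eta>)\<^sup>2 * (?c q \<bullet> \<eta>)\<^sup>2))"
    by (simp add: power2_eq_square[of "sum _ _"] sum_product sphere_mean_sum continuous_intros)
  also have "\<dots> = (\<Sum>p\<in>UNIV. \<Sum>q\<in>UNIV.
      ((?c p \<bullet> ?c p) * (?c q \<bullet> ?c q) + 2 * (?c p \<bullet> ?c q)\<^sup>2) / (n * (n + 2)))"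
    by (simp add: sphere_mean_inner_square_product n_def)
  also have "\<dots> = ((\<Sum>p\<in>UNIV. ?c p \<bullet> ?c p)\<^sup>2 + 2 * (\<Sum>p\<in>UNIV. \<Sum>q\<in>UNIV. (?c p \<bullet> ?c q)\<^sup>2))
      / (n * (n + 2))"
    by (simp only: power2_eq_square[of "sum _ _"] sum_product)
      (simp only: sum_distrib_left sum.distrib sum_divide_distrib add_divide_distrib)
  finally have square: "sphere_mean (\<lambda>\<eta>. (?Q \<eta>)\<^sup>2)
      = (n\<^sup>2 + 2 * (n + m * (3 * g\<^sub>1 + g\<^sub>2) / 4)) / (n * (n + 2))"
    by (simp only: trace trace_square)
  have "V = sphere_mean (\<lambda>\<eta>. (?Q \<eta>)\<^sup>2 + ((-2) * ?Q \<eta> + 1))"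
    unfolding assms(8) E norm_transpose_matrix_square
    by (intro arg_cong[where f = sphere_mean] ext) (simp add: power2_eq_square algebra_simps)
  also have "\<dots> = sphere_mean (\<lambda>\<eta>. (?Q \<eta>)\<^sup>2) + ((-2) * sphere_mean ?Q + 1)"
    by (simp only: sphere_mean_add sphere_mean_cmult sphere_mean_const continuous_intros)
  \<comment> \<open>With \<open>mean\<close>, the summand in parentheses is -1. It cancels
    \<open>n\<^sup>2 + 2 * n = n * (n + 2)\<close> in the numerator of \<open>square\<close>,
    leaving only the contribution of the degrees.\<close>
  also have "\<dots> = (m * (3 * g\<^sub>1 + g\<^sub>2) / 2) / (n * (n + 2))"
    unfolding square mean using n_pos
    by (simp add: divide_simps power2_eq_square) (simp add: algebra_simps)
  \<comment> \<open>Inserting \<open>n\<close> gives \<open>n * (n + 2) = m * (2 + g\<^sub>1) * (m *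
    (2 + g\<^sub>1) + 4) / 4\<close>. The signs of \<open>m\<close> and \<open>g\<^sub>1\<close>
    keep every factor nonzero.\<close>
  also have "\<dots> = (2 * g\<^sub>2 + 6 * g\<^sub>1) / ((2 + g\<^sub>1) * (m * (2 + g\<^sub>1) + 4))"
    using m g1 unfolding n by (simp add: divide_simps)
  also have "(2 + g\<^sub>1) * (m * (2 + g\<^sub>1) + 4) = (g\<^sub>1\<^sup>2 + 4 * g\<^sub>1 + 4) * m + (4 * g\<^sub>1 + 8)"
    by (simp add: power2_eq_square algebra_simps)
  finally show ?thesis
    using ineq E by simp
qed

end
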